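(* Let $G$ be a finite group, let $n\in\mathbb{N}$, let $x_1,\dots,x_n,d\in G$, and set $K_i=x_i^G$ for $1\le i\le n$ and $D=d^G$. Then $K_1\cdots K_n=D$ if and only if $$\chi(x_1)\cdots\chi(x_n)=\chi(1)^{n-1}\chi(d)$$ for all $\chi\in\mathrm{Irr}(G)$. In particular, if $K$ is a conjugacy class of $G$, $x\in K$ and $n\in\mathbb{N}$, then $K^n$ is a conjugacy class if and only if $$\chi(x)^n=\chi(1)^{n-1}\chi(x^n)$$ for all $\chi\in\mathrm{Irr}(G)$.
   Context: $x^G$ denotes the conjugacy class of $x$ in $G$. The product $K_1\cdots K_n$ is the set $\{k_1\cdots k_n : k_i\in K_i\}$, and $K^n$ is the product of $n$ copies of $K$. $\mathrm{Irr}(G)$ is the set of irreducible complex characters of $G$. $\mathbb{N}$ is the set of positive integers. *)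

theory Defs
  imports Jordan_Normal_Form.VS_Connect
begin

definition conj_class :: "('a, 'b) monoid_scheme \<Rightarrow> 'a \<Rightarrow> 'a set" where
  "conj_class G x = {inv\<^bsub>G\<^esub> g \<otimes>\<^bsub>G\<^esub> x \<otimes>\<^bsub>G\<^esub> g | g. g \<in> carrier G}"

definition conj_classes :: "('a, 'b) monoid_scheme \<Rightarrow> 'a set set" where
  "conj_classes G = conj_class G ` carrier G"

definition set_prod :: "('a, 'b) monoid_scheme \<Rightarrow> 'a set list \<Rightarrow> 'a set" where
  "set_prod G Ks = {foldr (\<otimes>\<^bsub>G\<^esub>) ks \<one>\<^bsub>G\<^esub> | ks. list_all2 (\<in>) ks Ks}"

definition GL :: "nat \<Rightarrow> complex mat monoid" where
  "GL m = units_of (ring_mat TYPE(complex) m ())"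

definition mat_rep :: "('a, 'b) monoid_scheme \<Rightarrow> nat \<Rightarrow> ('a \<Rightarrow> complex mat) \<Rightarrow> bool" where
  "mat_rep G m \<rho> \<longleftrightarrow> \<rho> \<in> hom G (GL m)"

text \<open>The zero-dimensional representation does not count as irreducible.\<close>

definition irreducible_rep :: "('a, 'b) monoid_scheme \<Rightarrow> nat \<Rightarrow> ('a \<Rightarrow> complex mat) \<Rightarrow> bool" where
  "irreducible_rep G m \<rho> \<longleftrightarrow> mat_rep G m \<rho> \<and> m > 0 \<and>
    (\<forall>W. subspace class_ring W (module_vec TYPE(complex) m) \<longrightarrow>
         (\<forall>g \<in> carrier G. \<forall>w \<in> W. \<rho> g *\<^sub>v w \<in> W) \<longrightarrow>
         W = {0\<^sub>v m} \<or> W = carrier_vec m)"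

definition mat_trace :: "complex mat \<Rightarrow> complex" where
  "mat_trace A = (\<Sum>i < dim_row A. A $$ (i, i))"

text \<open>Characters are restricted to the carrier so that they are determined by their values on
  the group.\<close>

definition Irr :: "('a, 'b) monoid_scheme \<Rightarrow> ('a \<Rightarrow> complex) set" where
  "Irr G = {restrict (\<lambda>g. mat_trace (\<rho> g)) (carrier G) | m \<rho>. irreducible_rep G m \<rho>}"

end

(*
  By Schur's lemma a class function acts on an irreducible representation as a scalar, determined
  by its character. Applied to the number N(z) of ways to write z as a product of conjugates of
  x_1, ..., x_n (counted with the conjugating elements) this gives
  sum_z N(z) chi(z) = |G|^n chi(x_1) ... chi(x_n) / chi(1)^(n-1). If N is supported on the class of
  d, the left side is |G|^n chi(d). Conversely, the character identities say that N and a multiple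
  of the indicator of the class of d have the same inner products with all irreducible characters,
  so they agree.

  That a class function f orthogonal to all irreducible characters vanishes is shown without
  complete reducibility: f acts on the regular representation by a matrix A commuting with G, as
  does its adjoint A*. If A is not 0, the image of A* contains an irreducible subrepresentation W,
  on which A is 0 by Schur. A nonzero w = A* u in W then satisfies |w|^2 = <u, A w> = 0.
*)

theory Submission
  imports Defs Jordan_Normal_Form.Spectral_Radius
begin

subsection \<open>Subspaces as images of injective matrices\<close>

text \<open>Subspaces of C^m phrased with the vector operations alone, so that the module records
  occur only when \<open>irreducible_rep\<close> is unfolded.\<close>

definition vec_closed :: "nat \<Rightarrow> complex vec set \<Rightarrow> bool" where
  "vec_closed m W \<longleftrightarrow> W \<subseteq> carrier_vec m \<and> 0\<^sub>v m \<in> W \<and>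
    (\<forall>v\<in>W. \<forall>w\<in>W. v + w \<in> W) \<and> (\<forall>c. \<forall>w\<in>W. c \<cdot>\<^sub>v w \<in> W)"

lemma subspace_iff_vec_closed:
  "VectorSpace.subspace class_ring W (module_vec TYPE(complex) m) \<longleftrightarrow> vec_closed m W"
proof -
  have vs: "vectorspace class_ring (module_vec TYPE(complex) m)"
    by (rule vec_vs)
  then have md: "Module.module class_ring (module_vec TYPE(complex) m)"
    by (simp add: vectorspace_def)
  show ?thesis
    using vs md
    by (auto simp: VectorSpace.subspace_def submodule_def vec_closed_def module_vec_simps)
qed

text \<open>Subspaces are handled through matrices whose columns form a basis: the image is the
  span, injectivity is linear independence. Restricting an action to a subspace then becomes a
  matrix equation \<open>L g * P = P * \<rho> g\<close>.\<close>

definition mat_image :: "complex mat \<Rightarrow> complex vec set" where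
  "mat_image Q = (\<lambda>v. Q *\<^sub>v v) ` carrier_vec (dim_col Q)"

definition mat_inj :: "complex mat \<Rightarrow> bool" where
  "mat_inj Q \<longleftrightarrow> (\<forall>v\<in>carrier_vec (dim_col Q). Q *\<^sub>v v = 0\<^sub>v (dim_row Q) \<longrightarrow> v = 0\<^sub>v (dim_col Q))"

lemma vec_closed_mat_image:
  assumes "Q \<in> carrier_mat m k"
  shows "vec_closed m (mat_image Q)"
  unfolding vec_closed_def
proof (intro conjI ballI allI)
  show "mat_image Q \<subseteq> carrier_vec m"
    using assms by (auto simp: mat_image_def)
  show "0\<^sub>v m \<in> mat_image Q"
    using assms unfolding mat_image_def
    by (intro image_eqI[of _ _ "0\<^sub>v k"]) (auto simp: mult_mat_vec_def)
next
  fix v w assume "v \<in> mat_image Q" "w \<in> mat_image Q"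
  then obtain a b where ab: "a \<in> carrier_vec k" "b \<in> carrier_vec k" "v = Q *\<^sub>v a" "w = Q *\<^sub>v b"
    using assms by (auto simp: mat_image_def)
  then have "v + w = Q *\<^sub>v (a + b)"
    using assms by (simp add: mult_add_distrib_mat_vec)
  then show "v + w \<in> mat_image Q"
    using ab assms by (auto simp: mat_image_def)
next
  fix c w assume "w \<in> mat_image Q"
  then obtain b where ab: "b \<in> carrier_vec k" "w = Q *\<^sub>v b"
    using assms by (auto simp: mat_image_def)
  then have "c \<cdot>\<^sub>v w = Q *\<^sub>v (c \<cdot>\<^sub>v b)"
    using assms by (simp add: mult_mat_vec)
  then show "c \<cdot>\<^sub>v w \<in> mat_image Q"
    using ab assms by (auto simp: mat_image_def)
qed

text \<open>Padding a matrix that has fewer rows than columns by zero rows gives a singular square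
  matrix; a nonzero vector in its kernel is also killed by the original matrix.\<close>

lemma mat_inj_dim_le:
  assumes Q: "Q \<in> carrier_mat m k" and inj: "mat_inj Q"
  shows "k \<le> m"
proof (rule ccontr)
  assume "\<not> k \<le> m"
  then have mk: "m < k" by simp
  define R where "R = mat k k (\<lambda>(i,j). if i < m then Q $$ (i,j) else 0)"
  have R: "R \<in> carrier_mat k k" by (simp add: R_def)
  have row0: "row R m = 0\<^sub>v k"
    using mk by (intro eq_vecI) (auto simp: R_def)
  \<comment> \<open>A zero row rules out a right inverse, since the diagonal entry of
    \<open>R * S\<close> in that row would be 0 instead of 1.\<close>
  have "det R = 0"
  proof (rule ccontr)
    assume "det R \<noteq> 0"
    then obtain S where S: "S \<in> carrier_mat k k" "R * S = 1\<^sub>m k"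
      using det_non_zero_imp_unit[OF R, of "()"]
      by (auto simp: Units_def ring_mat_simps)
    have "(R * S) $$ (m,m) = row R m \<bullet> col S m" using R S(1) mk by simp
    also have "\<dots> = 0" unfolding row0 by (rule scalar_prod_left_zero) (use S mk in auto)
    finally have "(R * S) $$ (m,m) = 0" .
    then show False using S mk by simp
  qed
  then obtain v where v: "v \<in> carrier_vec k" "v \<noteq> 0\<^sub>v k" "R *\<^sub>v v = 0\<^sub>v k"
    using det_0_iff_vec_prod_zero[OF R] by auto
  have "Q *\<^sub>v v = 0\<^sub>v m"
  proof (intro eq_vecI)
    fix i assume i: "i < dim_vec (0\<^sub>v m :: complex vec)"
    then have "(Q *\<^sub>v v) $ i = (R *\<^sub>v v) $ i"
      using Q v(1) mk by (auto simp: scalar_prod_def R_def)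
    then show "(Q *\<^sub>v v) $ i = 0\<^sub>v m $ i" using v i mk by simp
  qed (use Q in auto)
  then show False using inj Q v by (auto simp: mat_inj_def)
qed

lemma mat_inj_square_surj:
  assumes Q: "Q \<in> carrier_mat m m" and inj: "mat_inj Q"
  shows "mat_image Q = carrier_vec m"
proof -
  have "det Q \<noteq> 0"
    using det_0_iff_vec_prod_zero[OF Q] inj Q by (auto simp: mat_inj_def)
  then obtain S where S: "S \<in> carrier_mat m m" "Q * S = 1\<^sub>m m"
    using det_non_zero_imp_unit[OF Q, of "()"]
    by (auto simp: Units_def ring_mat_simps)
  have "v \<in> mat_image Q" if v: "v \<in> carrier_vec m" for v
  proof -
    have "Q *\<^sub>v (S *\<^sub>v v) = v"
      using assoc_mult_mat_vec[OF Q S(1) v] S v by simp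
    then show ?thesis using Q S v unfolding mat_image_def
      by (intro image_eqI[of _ _ "S *\<^sub>v v"]) auto
  qed
  then show ?thesis using Q by (auto simp: mat_image_def)
qed

text \<open>An independent family in \<open>W\<close> that does not span \<open>W\<close> can be
  enlarged: a vector outside the span becomes the new last column.\<close>

lemma mat_inj_append_col:
  assumes Q: "Q \<in> carrier_mat m k" and inj: "mat_inj Q" and W: "vec_closed m W"
    and QW: "mat_image Q \<subseteq> W" and w: "w \<in> W" "w \<notin> mat_image Q"
  shows "\<exists>Q'\<in>carrier_mat m (Suc k). mat_inj Q' \<and> mat_image Q' \<subseteq> W"
proof -
  define Q' where "Q' = mat m (Suc k) (\<lambda>(i,j). if j < k then Q $$ (i,j) else w $ i)"
  have Q': "Q' \<in> carrier_mat m (Suc k)" by (simp add: Q'_def)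
  have wc: "w \<in> carrier_vec m" using w W by (auto simp: vec_closed_def)
  have split: "Q' *\<^sub>v v = Q *\<^sub>v vec k (\<lambda>i. v $ i) + (v $ k) \<cdot>\<^sub>v w"
    if v: "v \<in> carrier_vec (Suc k)" for v
    using v Q wc by (intro eq_vecI) (auto simp: Q'_def scalar_prod_def)
  have part: "vec k (\<lambda>i. v $ i) \<in> carrier_vec k" for v :: "complex vec" by simp
  have "mat_inj Q'"
    unfolding mat_inj_def
  proof (intro ballI impI)
    fix v assume "v \<in> carrier_vec (dim_col Q')" and z: "Q' *\<^sub>v v = 0\<^sub>v (dim_row Q')"
    then have v: "v \<in> carrier_vec (Suc k)" using Q' by simp
    let ?u = "vec k (\<lambda>i. v $ i)"
    have eq: "Q *\<^sub>v ?u + (v $ k) \<cdot>\<^sub>v w = 0\<^sub>v m" using split[OF v] z Q' by simp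
    \<comment> \<open>Otherwise the relation \<open>eq\<close> could be solved for \<open>w\<close>,
      placing it in the span of the old columns.\<close>
    have vk: "v $ k = 0"
    proof (rule ccontr)
      assume nz: "v $ k \<noteq> 0"
      have "w = Q *\<^sub>v ((- 1 / v $ k) \<cdot>\<^sub>v ?u)"
      proof (intro eq_vecI)
        fix i assume "i < dim_vec (Q *\<^sub>v ((- 1 / v $ k) \<cdot>\<^sub>v ?u))"
        then have i: "i < m" using Q by simp
        have "(Q *\<^sub>v ?u) $ i + v $ k * w $ i = 0"
          using arg_cong[OF eq, of "\<lambda>x. x $ i"] i Q wc by simp
        then have "w $ i = (- 1 / v $ k) * (Q *\<^sub>v ?u) $ i"
          using nz by (simp add: field_simps eq_neg_iff_add_eq_0)
        also have "\<dots> = (Q *\<^sub>v ((- 1 / v $ k) \<cdot>\<^sub>v ?u)) $ i"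
          using mult_mat_vec[OF Q part, of "- 1 / v $ k" v] i Q by simp
        finally show "w $ i = (Q *\<^sub>v ((- 1 / v $ k) \<cdot>\<^sub>v ?u)) $ i" .
      qed (use Q wc in auto)
      then have "w \<in> mat_image Q" using Q unfolding mat_image_def
        by (intro image_eqI[of _ _ "(- 1 / v $ k) \<cdot>\<^sub>v ?u"]) auto
      then show False using w by simp
    qed
    have "Q *\<^sub>v ?u = 0\<^sub>v m"
      using eq vk Q wc by (auto simp: vec_eq_iff)
    then have u: "?u = 0\<^sub>v k" using inj Q by (auto simp: mat_inj_def)
    have "v $ i = 0" if "i < Suc k" for i
      using vk that arg_cong[OF u, of "\<lambda>x. x $ i"] by (cases "i = k") auto
    then show "v = 0\<^sub>v (dim_col Q')" using v Q' by (intro eq_vecI) auto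
  qed
  moreover have "mat_image Q' \<subseteq> W"
  proof
    fix y assume "y \<in> mat_image Q'"
    then obtain v where v: "v \<in> carrier_vec (Suc k)" "y = Q' *\<^sub>v v"
      using Q' by (auto simp: mat_image_def)
    have "Q *\<^sub>v vec k (\<lambda>i. v $ i) \<in> W" using QW Q by (auto simp: mat_image_def)
    then show "y \<in> W" using split[OF v(1)] v w W by (auto simp: vec_closed_def)
  qed
  ultimately show ?thesis using Q' by blast
qed

text \<open>Take as many independent columns inside \<open>W\<close> as possible. Their number is at
  most \<open>m\<close>, and a maximal family spans because it could otherwise be enlarged.\<close>

lemma vec_closed_obtains_basis:
  assumes W: "vec_closed m W"
  obtains k Q where "Q \<in> carrier_mat m k" "mat_inj Q" "mat_image Q = W"
proof -
  define P where "P k \<longleftrightarrow> (\<exists>Q\<in>carrier_mat m k. mat_inj Q \<and> mat_image Q \<subseteq> W)" for k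
  \<comment> \<open>The matrix without columns starts the search: it is the empty basis.\<close>
  have "mat_image (0\<^sub>m m 0) \<subseteq> W"
  proof -
    have "0\<^sub>m m 0 *\<^sub>v v = 0\<^sub>v m" if "v \<in> carrier_vec 0" for v :: "complex vec"
      using that by (intro eq_vecI) (auto simp: scalar_prod_def)
    then show ?thesis using W by (auto simp: mat_image_def vec_closed_def)
  qed
  then have "P 0" by (auto simp: P_def mat_inj_def intro!: bexI[of _ "0\<^sub>m m 0"])
  moreover have bound: "P k \<Longrightarrow> k \<le> m" for k using mat_inj_dim_le by (auto simp: P_def)
  ultimately have "P (Greatest P)" and max: "P k \<Longrightarrow> k \<le> Greatest P" for k
    by (auto intro: GreatestI_nat Greatest_le_nat)
  then obtain Q where Q: "Q \<in> carrier_mat m (Greatest P)" "mat_inj Q" "mat_image Q \<subseteq> W"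
    by (auto simp: P_def)
  have "W \<subseteq> mat_image Q"
  proof (rule ccontr)
    assume "\<not> W \<subseteq> mat_image Q"
    then have "P (Suc (Greatest P))"
      using mat_inj_append_col[OF Q(1,2) W Q(3)] by (auto simp: P_def)
    from max[OF this] show False by simp
  qed
  with Q that show thesis by blast
qed

lemma mat_inj_cancel:
  assumes Q: "Q \<in> carrier_mat m k" and inj: "mat_inj Q"
    and A: "A \<in> carrier_mat k n" and B: "B \<in> carrier_mat k n" and eq: "Q * A = Q * B"
  shows "A = B"
proof (rule eq_matI)
  fix i j assume ij: "i < dim_row B" "j < dim_col B"
  have c: "col A j \<in> carrier_vec k" "col B j \<in> carrier_vec k" using A B by auto
  have "Q *\<^sub>v (col A j - col B j) = Q *\<^sub>v col A j - Q *\<^sub>v col B j"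
    using mult_minus_distrib_mat_vec[OF Q c] .
  also have "\<dots> = col (Q * A) j - col (Q * B) j"
    using ij A B by (simp add: col_mult2[OF Q A] col_mult2[OF Q B])
  also have "\<dots> = 0\<^sub>v m" using eq Q B ij by auto
  finally have "col A j - col B j = 0\<^sub>v k"
    using inj Q c by (auto simp: mat_inj_def)
  then have "(col A j - col B j) $ i = 0" using ij B by simp
  then show "A $$ (i,j) = B $$ (i,j)" using ij A B by simp
qed (use A B in auto)

text \<open>The columns of \<open>A\<close> are images of unit vectors, hence have coordinates with
  respect to the columns of \<open>Q\<close>; these coordinates are the columns of \<open>B\<close>.
  This produces the matrices of a restricted action.\<close>

lemma mat_image_factor:
  assumes Q: "Q \<in> carrier_mat m k" and A: "A \<in> carrier_mat m n"
    and im: "\<And>v. v \<in> carrier_vec n \<Longrightarrow> A *\<^sub>v v \<in> mat_image Q"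
  shows "\<exists>B\<in>carrier_mat k n. A = Q * B"
proof -
  have "\<exists>b. b \<in> carrier_vec k \<and> col A j = Q *\<^sub>v b" if "j < n" for j
  proof -
    have "col A j = A *\<^sub>v unit_vec n j"
      using A that by (intro eq_vecI) auto
    then show ?thesis using im[of "unit_vec n j"] Q by (auto simp: mat_image_def)
  qed
  then obtain b where b: "\<And>j. j < n \<Longrightarrow> b j \<in> carrier_vec k \<and> col A j = Q *\<^sub>v b j" by metis
  define B where "B = mat k n (\<lambda>(i,j). b j $ i)"
  have B: "B \<in> carrier_mat k n" by (simp add: B_def)
  have colB: "col B j = b j" if "j < n" for j
    using b[OF that] that by (intro eq_vecI) (auto simp: B_def)
  have "A = Q * B"
  proof (rule eq_matI)
    fix i j assume ij: "i < dim_row (Q * B)" "j < dim_col (Q * B)"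
    then have j: "j < n" and i: "i < m" using B Q by auto
    have "A $$ (i,j) = col A j $ i" using A i j by simp
    also have "\<dots> = (Q *\<^sub>v col B j) $ i" using b[OF j] colB[OF j] by simp
    also have "\<dots> = (Q * B) $$ (i,j)" using i j Q B by simp
    finally show "A $$ (i,j) = (Q * B) $$ (i,j)" .
  qed (use A B Q in auto)
  then show ?thesis using B by blast
qed

subsection \<open>Linear combinations and traces of matrices\<close>

text \<open>Finite linear combinations of matrices, taken entrywise. The dimensions are arguments
  because the type \<open>complex mat\<close> does not determine them.\<close>

definition msum :: "'i set \<Rightarrow> nat \<Rightarrow> nat \<Rightarrow> ('i \<Rightarrow> complex) \<Rightarrow> ('i \<Rightarrow> complex mat) \<Rightarrow> complex mat" where
  "msum S nr nc f F = mat nr nc (\<lambda>(i,j). \<Sum>g\<in>S. f g * F g $$ (i,j))"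

lemma msum_carrier [simp]: "msum S nr nc f F \<in> carrier_mat nr nc"
  by (simp add: msum_def)

lemma msum_dim [simp]: "dim_row (msum S nr nc f F) = nr" "dim_col (msum S nr nc f F) = nc"
  by (simp_all add: msum_def)

lemma msum_index [simp]:
  "i < nr \<Longrightarrow> j < nc \<Longrightarrow> msum S nr nc f F $$ (i,j) = (\<Sum>g\<in>S. f g * F g $$ (i,j))"
  by (simp add: msum_def)

lemma msum_cong:
  assumes "\<And>g. g \<in> S \<Longrightarrow> f g = f' g" "\<And>g. g \<in> S \<Longrightarrow> F g = F' g"
  shows "msum S nr nc f F = msum S nr nc f' F'"
  using assms by (intro eq_matI) auto

lemma mult_msum:
  assumes C: "C \<in> carrier_mat n0 n1" and F: "\<And>g. g \<in> S \<Longrightarrow> F g \<in> carrier_mat n1 n2"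
  shows "C * msum S n1 n2 f F = msum S n0 n2 f (\<lambda>g. C * F g)"
proof (rule eq_matI)
  fix i j assume "i < dim_row (msum S n0 n2 f (\<lambda>g. C * F g))"
    "j < dim_col (msum S n0 n2 f (\<lambda>g. C * F g))"
  then have ij: "i < n0" "j < n2" by auto
  have "(C * msum S n1 n2 f F) $$ (i,j) = (\<Sum>k<n1. \<Sum>g\<in>S. f g * (C $$ (i,k) * F g $$ (k,j)))"
    using C ij by (simp add: scalar_prod_def sum_distrib_left ac_simps atLeast0LessThan)
  also have "\<dots> = (\<Sum>g\<in>S. f g * (\<Sum>k<n1. C $$ (i,k) * F g $$ (k,j)))"
    by (subst sum.swap) (simp add: sum_distrib_left)
  also have "\<dots> = (\<Sum>g\<in>S. f g * (C * F g) $$ (i,j))"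
    using C F ij by (intro sum.cong) (force simp: scalar_prod_def atLeast0LessThan)+
  finally show "(C * msum S n1 n2 f F) $$ (i,j) = msum S n0 n2 f (\<lambda>g. C * F g) $$ (i,j)"
    using ij by simp
qed (use C in auto)

lemma msum_mult:
  assumes C: "C \<in> carrier_mat n1 n2" and F: "\<And>g. g \<in> S \<Longrightarrow> F g \<in> carrier_mat n0 n1"
  shows "msum S n0 n1 f F * C = msum S n0 n2 f (\<lambda>g. F g * C)"
proof (rule eq_matI)
  fix i j assume "i < dim_row (msum S n0 n2 f (\<lambda>g. F g * C))"
    "j < dim_col (msum S n0 n2 f (\<lambda>g. F g * C))"
  then have ij: "i < n0" "j < n2" by auto
  have "(msum S n0 n1 f F * C) $$ (i,j) = (\<Sum>k<n1. \<Sum>g\<in>S. f g * (F g $$ (i,k) * C $$ (k,j)))"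
    using C ij by (simp add: scalar_prod_def sum_distrib_right mult.assoc atLeast0LessThan)
  also have "\<dots> = (\<Sum>g\<in>S. f g * (\<Sum>k<n1. F g $$ (i,k) * C $$ (k,j)))"
    by (subst sum.swap) (simp add: sum_distrib_left)
  also have "\<dots> = (\<Sum>g\<in>S. f g * (F g * C) $$ (i,j))"
    using C F ij by (intro sum.cong) (force simp: scalar_prod_def atLeast0LessThan)+
  finally show "(msum S n0 n1 f F * C) $$ (i,j) = msum S n0 n2 f (\<lambda>g. F g * C) $$ (i,j)"
    using ij by simp
qed (use C in auto)

lemma mat_trace_comm:
  assumes "A \<in> carrier_mat m n" "B \<in> carrier_mat n m"
  shows "mat_trace (A * B) = mat_trace (B * A)"
proof -
  have "mat_trace (A * B) = (\<Sum>i<m. \<Sum>k<n. A $$ (i,k) * B $$ (k,i))"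
    using assms by (simp add: mat_trace_def scalar_prod_def atLeast0LessThan)
  also have "\<dots> = mat_trace (B * A)"
    using assms by (subst sum.swap) (simp add: mat_trace_def scalar_prod_def atLeast0LessThan mult.commute)
  finally show ?thesis .
qed

lemma scalar_mat_mult:
  fixes a b :: complex
  shows "(a \<cdot>\<^sub>m 1\<^sub>m m) * (b \<cdot>\<^sub>m 1\<^sub>m m) = (a * b) \<cdot>\<^sub>m 1\<^sub>m m"
  by (subst mult_smult_assoc_mat[of _ m m _ m]) (auto intro!: eq_matI)

subsection \<open>Representations and Schur's lemma\<close>

lemma GL_group: "group (GL m)"
proof -
  interpret R: ring "ring_mat TYPE(complex) m ()" by (rule ring_mat)
  show ?thesis unfolding GL_def by (rule R.units_group)
qed

lemma GL_simps:
  "x \<otimes>\<^bsub>GL m\<^esub> y = x * y" "\<one>\<^bsub>GL m\<^esub> = 1\<^sub>m m" "carrier (GL m) = Units (ring_mat TYPE(complex) m ())"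
  by (simp_all add: GL_def units_of_def ring_mat_simps)

context group
begin

lemma mat_rep_carrier:
  "mat_rep G m \<rho> \<Longrightarrow> g \<in> carrier G \<Longrightarrow> \<rho> g \<in> carrier_mat m m"
  by (auto simp: mat_rep_def hom_def GL_simps Units_def ring_mat_simps Pi_iff)

lemma mat_rep_mult:
  "mat_rep G m \<rho> \<Longrightarrow> g \<in> carrier G \<Longrightarrow> h \<in> carrier G \<Longrightarrow> \<rho> (g \<otimes> h) = \<rho> g * \<rho> h"
  by (auto simp: mat_rep_def hom_def GL_simps)

lemma mat_rep_one:
  assumes "mat_rep G m \<rho>"
  shows "\<rho> \<one> = 1\<^sub>m m"
proof -
  have "group_hom G (GL m) \<rho>"
    using assms GL_group group_axioms
    by (simp add: group_hom_def group_hom_axioms_def mat_rep_def)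
  from group_hom.hom_one[OF this] show ?thesis by (simp add: GL_simps)
qed

text \<open>Invertibility comes for free: \<open>\<rho> (inv g)\<close> is the inverse of
  \<open>\<rho> g\<close>.\<close>

lemma mat_repI:
  assumes c: "\<And>g. g \<in> carrier G \<Longrightarrow> \<rho> g \<in> carrier_mat m m"
    and m: "\<And>g h. g \<in> carrier G \<Longrightarrow> h \<in> carrier G \<Longrightarrow> \<rho> (g \<otimes> h) = \<rho> g * \<rho> h"
    and o: "\<rho> \<one> = 1\<^sub>m m"
  shows "mat_rep G m \<rho>"
proof -
  have "\<rho> g \<in> Units (ring_mat TYPE(complex) m ())" if g: "g \<in> carrier G" for g
    using c[OF g] c[OF inv_closed[OF g]] m[OF g inv_closed[OF g]] m[OF inv_closed[OF g] g] o g
    by (auto simp: Units_def ring_mat_simps intro!: bexI[of _ "\<rho> (inv g)"])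
  then show ?thesis using m by (auto simp: mat_rep_def hom_def GL_simps)
qed

text \<open>Over the complex numbers \<open>T\<close> has an eigenvalue. Its eigenspace is nonzero
  and, as \<open>T\<close> commutes with the action, invariant; so it is the whole space.\<close>

lemma schur_scalar:
  assumes irr: "irreducible_rep G m \<rho>" and T: "T \<in> carrier_mat m m"
    and comm: "\<And>g. g \<in> carrier G \<Longrightarrow> \<rho> g * T = T * \<rho> g"
  obtains c where "T = c \<cdot>\<^sub>m 1\<^sub>m m"
proof -
  have m: "m > 0" and rep: "mat_rep G m \<rho>"
    using irr by (auto simp: irreducible_rep_def)
  obtain c v where "eigenvector T v c"
    using spectrum_non_empty[OF T m] by (auto simp: spectrum_def eigenvalue_def)
  then have v: "v \<in> carrier_vec m" "v \<noteq> 0\<^sub>v m" "T *\<^sub>v v = c \<cdot>\<^sub>v v"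
    using T by (auto simp: eigenvector_def)
  define W where "W = {w \<in> carrier_vec m. T *\<^sub>v w = c \<cdot>\<^sub>v w}"
  have "vec_closed m W"
    using T by (auto simp: vec_closed_def W_def mult_add_distrib_mat_vec mult_mat_vec
        smult_add_distrib_vec smult_smult_assoc mult.commute)
  moreover have "\<rho> g *\<^sub>v w \<in> W" if g: "g \<in> carrier G" and w: "w \<in> W" for g w
  proof -
    note R = mat_rep_carrier[OF rep g]
    have wc: "w \<in> carrier_vec m" "T *\<^sub>v w = c \<cdot>\<^sub>v w" using w by (auto simp: W_def)
    have "T *\<^sub>v (\<rho> g *\<^sub>v w) = (T * \<rho> g) *\<^sub>v w"
      using assoc_mult_mat_vec[OF T R wc(1)] by simp
    also have "\<dots> = \<rho> g *\<^sub>v (T *\<^sub>v w)"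
      using comm[OF g] assoc_mult_mat_vec[OF R T wc(1)] by simp
    also have "\<dots> = c \<cdot>\<^sub>v (\<rho> g *\<^sub>v w)"
      using wc R by (simp add: mult_mat_vec)
    finally show ?thesis using R wc by (auto simp: W_def)
  qed
  ultimately have "W = {0\<^sub>v m} \<or> W = carrier_vec m"
    using irr by (auto simp: irreducible_rep_def subspace_iff_vec_closed)
  then have W: "W = carrier_vec m" using v by (auto simp: W_def)
  have "T = c \<cdot>\<^sub>m 1\<^sub>m m"
  proof (rule eq_matI)
    fix i j assume "i < dim_row (c \<cdot>\<^sub>m 1\<^sub>m m :: complex mat)" "j < dim_col (c \<cdot>\<^sub>m 1\<^sub>m m :: complex mat)"
    then have ij: "i < m" "j < m" by auto
    \<comment> \<open>Applying \<open>T\<close> to the unit vectors reads off its columns.\<close>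
    have "unit_vec m j \<in> W" using W by simp
    then have "T *\<^sub>v unit_vec m j = c \<cdot>\<^sub>v unit_vec m j" by (simp add: W_def)
    from arg_cong[OF this, of "\<lambda>x. x $ i"]
    show "T $$ (i,j) = (c \<cdot>\<^sub>m 1\<^sub>m m) $$ (i,j)" using T ij by simp
  qed (use T in auto)
  then show thesis by (rule that)
qed

section \<open>Class functions as central elements of the group algebra\<close>

definition class_fun :: "('a \<Rightarrow> complex) \<Rightarrow> bool" where
  "class_fun f \<longleftrightarrow> (\<forall>g\<in>carrier G. \<forall>h\<in>carrier G. f (inv h \<otimes> g \<otimes> h) = f g)"

text \<open>The matrix by which the group algebra element with coefficients \<open>f\<close> acts
  under \<open>\<rho>\<close>.\<close>

abbreviation rep_sum :: "nat \<Rightarrow> ('a \<Rightarrow> complex mat) \<Rightarrow> ('a \<Rightarrow> complex) \<Rightarrow> complex mat" where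
  "rep_sum m \<rho> f \<equiv> msum (carrier G) m m f \<rho>"

text \<open>Replacing the summation variable g by h g h^-1 moves \<open>\<rho> h\<close> from one
  side to the other, while the coefficients of a class function stay the same.\<close>

lemma rep_sum_commute:
  assumes rep: "mat_rep G m \<rho>" and f: "class_fun f" and h: "h \<in> carrier G"
  shows "\<rho> h * rep_sum m \<rho> f = rep_sum m \<rho> f * \<rho> h"
proof -
  note R = mat_rep_carrier[OF rep]
  have "\<rho> h * rep_sum m \<rho> f = rep_sum m (\<lambda>g. \<rho> h * \<rho> g) f"
    by (rule mult_msum) (use R h in auto)
  also have "\<dots> = rep_sum m (\<lambda>g. \<rho> g * \<rho> h) f"
  proof (rule eq_matI)
    fix i j assume "i < dim_row (rep_sum m (\<lambda>g. \<rho> g * \<rho> h) f)" "j < dim_col (rep_sum m (\<lambda>g. \<rho> g * \<rho> h) f)"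
    then have ij: "i < m" "j < m" by auto
    have "(\<Sum>g\<in>carrier G. f g * (\<rho> h * \<rho> g) $$ (i,j)) = (\<Sum>g\<in>carrier G. f g * (\<rho> g * \<rho> h) $$ (i,j))"
    proof (rule sum.reindex_bij_witness[of _ "\<lambda>g. inv h \<otimes> g \<otimes> h" "\<lambda>g. h \<otimes> g \<otimes> inv h"])
      fix g assume g: "g \<in> carrier G"
      have a: "inv h \<otimes> (h \<otimes> g \<otimes> inv h) \<otimes> h = g"
        using g h by (simp add: m_assoc) (simp add: m_assoc[symmetric])
      show "inv h \<otimes> (h \<otimes> g \<otimes> inv h) \<otimes> h = g" by (rule a)
      show "h \<otimes> (inv h \<otimes> g \<otimes> h) \<otimes> inv h = g"
        using g h by (simp add: m_assoc) (simp add: m_assoc[symmetric])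
      show "h \<otimes> g \<otimes> inv h \<in> carrier G" "inv h \<otimes> g \<otimes> h \<in> carrier G"
        using g h by auto
      have "f (h \<otimes> g \<otimes> inv h) = f g"
        using f g h a unfolding class_fun_def by (metis inv_closed m_closed)
      moreover have "\<rho> (h \<otimes> g \<otimes> inv h) * \<rho> h = \<rho> h * \<rho> g"
      proof -
        have "\<rho> (h \<otimes> g \<otimes> inv h) * \<rho> h = \<rho> (h \<otimes> g \<otimes> inv h \<otimes> h)"
          using g h by (simp add: mat_rep_mult[OF rep])
        also have "h \<otimes> g \<otimes> inv h \<otimes> h = h \<otimes> g" using g h by (simp add: m_assoc)
        finally show ?thesis using g h by (simp add: mat_rep_mult[OF rep])
      qed
      ultimately show "f (h \<otimes> g \<otimes> inv h) * (\<rho> (h \<otimes> g \<otimes> inv h) * \<rho> h) $$ (i,j) =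
          f g * (\<rho> h * \<rho> g) $$ (i,j)" by simp
    qed
    then show "rep_sum m (\<lambda>g. \<rho> h * \<rho> g) f $$ (i,j) = rep_sum m (\<lambda>g. \<rho> g * \<rho> h) f $$ (i,j)"
      using ij by simp
  qed auto
  also have "\<dots> = rep_sum m \<rho> f * \<rho> h"
    by (rule msum_mult[symmetric]) (use R h in auto)
  finally show ?thesis .
qed

text \<open>Schur's lemma makes the matrix scalar, and comparing traces determines the
  scalar.\<close>

lemma rep_sum_scalar:
  assumes irr: "irreducible_rep G m \<rho>" and f: "class_fun f"
  shows "rep_sum m \<rho> f = ((\<Sum>g\<in>carrier G. f g * mat_trace (\<rho> g)) / of_nat m) \<cdot>\<^sub>m 1\<^sub>m m"
proof -
  have m: "m > 0" and rep: "mat_rep G m \<rho>"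
    using irr by (auto simp: irreducible_rep_def)
  obtain c where c: "rep_sum m \<rho> f = c \<cdot>\<^sub>m 1\<^sub>m m"
    using schur_scalar[OF irr msum_carrier] rep_sum_commute[OF rep f] by metis
  have "(\<Sum>g\<in>carrier G. f g * mat_trace (\<rho> g)) = (\<Sum>g\<in>carrier G. \<Sum>i<m. f g * \<rho> g $$ (i,i))"
    using mat_rep_carrier[OF rep]
    by (intro sum.cong) (auto simp: mat_trace_def sum_distrib_left)
  also have "\<dots> = (\<Sum>i<m. rep_sum m \<rho> f $$ (i,i))"
    by (subst sum.swap) simp
  also have "\<dots> = of_nat m * c" unfolding c by simp
  finally show ?thesis using c m by simp
qed

subsection \<open>Class functions orthogonal to all irreducible characters\<close>

text \<open>Left multiplication as a permutation matrix: \<open>e\<close> numbers the group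
  elements, and \<open>g\<close> sends the basis vector of \<open>e j\<close> to that of
  \<open>g \<otimes> e j\<close>.\<close>

definition regular_rep :: "nat \<Rightarrow> (nat \<Rightarrow> 'a) \<Rightarrow> 'a \<Rightarrow> complex mat" where
  "regular_rep N e g = mat N N (\<lambda>(i,j). if e i = g \<otimes> e j then 1 else 0)"

lemma regular_rep:
  assumes e: "bij_betw e {..<N} (carrier G)"
  shows "mat_rep G N (regular_rep N e)"
proof (rule mat_repI)
  have ec: "e i \<in> carrier G" if "i < N" for i using e that by (auto simp: bij_betw_def)
  have inj: "e i = e j \<longleftrightarrow> i = j" if "i < N" "j < N" for i j
    using e that by (auto simp: bij_betw_def inj_on_def)
  show "regular_rep N e g \<in> carrier_mat N N" for g by (simp add: regular_rep_def)
  show "regular_rep N e \<one> = 1\<^sub>m N"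
    using ec inj by (intro eq_matI) (auto simp: regular_rep_def)
  fix g h assume g: "g \<in> carrier G" and h: "h \<in> carrier G"
  show "regular_rep N e (g \<otimes> h) = regular_rep N e g * regular_rep N e h"
  proof (rule eq_matI)
    fix i j assume "i < dim_row (regular_rep N e g * regular_rep N e h)"
      "j < dim_col (regular_rep N e g * regular_rep N e h)"
    then have ij: "i < N" "j < N" by (auto simp: regular_rep_def)
    have "h \<otimes> e j \<in> e ` {..<N}" using e ij ec h by (auto simp: bij_betw_def)
    then obtain k where k: "k < N" "e k = h \<otimes> e j" by auto
    have "(regular_rep N e g * regular_rep N e h) $$ (i,j) =
        (\<Sum>l<N. (if e i = g \<otimes> e l then 1 else 0) * (if e l = h \<otimes> e j then 1 else 0))"
      using ij by (simp add: regular_rep_def scalar_prod_def atLeast0LessThan)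
    \<comment> \<open>The column of \<open>e j\<close> under \<open>h\<close> has its only nonzero
      entry at the index \<open>k\<close> of \<open>h \<otimes> e j\<close>.\<close>
    also have "\<dots> = (\<Sum>l<N. if l = k then (if e i = g \<otimes> e l then 1 else 0) else 0)"
      using k(2)[symmetric] inj[OF _ k(1)] by (intro sum.cong) auto
    also have "\<dots> = (if e i = g \<otimes> e k then 1 else 0)"
      using k by simp
    also have "\<dots> = regular_rep N e (g \<otimes> h) $$ (i,j)"
      using ij k g h ec by (simp add: regular_rep_def m_assoc)
    finally show "regular_rep N e (g \<otimes> h) $$ (i,j) = (regular_rep N e g * regular_rep N e h) $$ (i,j)" ..
  qed (auto simp: regular_rep_def)
qed

text \<open>Only one group element carries \<open>e j\<close> to \<open>e i\<close>. Hence the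
  values of \<open>f\<close> can be read off the matrix, which is therefore nonzero as soon as
  \<open>f\<close> is nonzero somewhere on the group.\<close>

lemma regular_rep_sum:
  assumes e: "bij_betw e {..<N} (carrier G)" and ij: "i < N" "j < N"
  shows "rep_sum N (regular_rep N e) f $$ (i,j) = f (e i \<otimes> inv (e j))"
proof -
  have fin: "finite (carrier G)" using e bij_betw_finite by blast
  have ec: "e i \<in> carrier G" "e j \<in> carrier G" using e ij by (auto simp: bij_betw_def)
  have "rep_sum N (regular_rep N e) f $$ (i,j) = (\<Sum>g\<in>carrier G. f g * (if e i = g \<otimes> e j then 1 else 0))"
    using ij by (simp add: regular_rep_def)
  also have "\<dots> = (\<Sum>g\<in>carrier G. if g = e i \<otimes> inv (e j) then f g else 0)"
    using ec by (intro sum.cong) (auto simp: inv_solve_right)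
  also have "\<dots> = f (e i \<otimes> inv (e j))" using fin ec by simp
  finally show ?thesis .
qed

section \<open>Subrepresentations and the existence of irreducible ones\<close>

lemma subrep_hom:
  assumes rep: "mat_rep G N L" and P: "P \<in> carrier_mat N k" "mat_inj P"
    and c: "\<And>g. g \<in> carrier G \<Longrightarrow> \<rho> g \<in> carrier_mat k k"
    and eq: "\<And>g. g \<in> carrier G \<Longrightarrow> L g * P = P * \<rho> g"
  shows "mat_rep G k \<rho>"
proof (rule mat_repI[OF c])
  note R = mat_rep_carrier[OF rep]
  \<comment> \<open>Both homomorphism laws are transported from \<open>L\<close> along
    \<open>P\<close>, which is then cancelled on the left by injectivity.\<close>
  have "P * \<rho> \<one> = P * 1\<^sub>m k"
    using eq[OF one_closed] mat_rep_one[OF rep] P by simp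
  then show "\<rho> \<one> = 1\<^sub>m k"
    using mat_inj_cancel[OF P] c by (metis one_carrier_mat one_closed)
  fix g h assume g: "g \<in> carrier G" and h: "h \<in> carrier G"
  have "P * \<rho> (g \<otimes> h) = L g * L h * P"
    using eq[of "g \<otimes> h"] g h mat_rep_mult[OF rep] by simp
  also have "\<dots> = L g * (P * \<rho> h)"
    using eq[OF h] assoc_mult_mat[OF R[OF g] R[OF h] P(1)] by simp
  also have "\<dots> = P * \<rho> g * \<rho> h"
    using eq[OF g] assoc_mult_mat[OF R[OF g] P(1) c[OF h]] by simp
  also have "\<dots> = P * (\<rho> g * \<rho> h)"
    using assoc_mult_mat[OF P(1) c[OF g] c[OF h]] .
  finally show "\<rho> (g \<otimes> h) = \<rho> g * \<rho> h"
    using mat_inj_cancel[OF P] c g h by (metis m_closed mult_carrier_mat)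
qed

text \<open>A nonzero invariant subspace of least dimension inside \<open>U\<close> is irreducible,
  since a proper nonzero invariant subspace of it would have smaller dimension.\<close>

lemma invariant_contains_irreducible:
  assumes rep: "mat_rep G N L" and U: "vec_closed N U" and nz: "U \<noteq> {0\<^sub>v N}"
    and inv: "\<And>g w. g \<in> carrier G \<Longrightarrow> w \<in> U \<Longrightarrow> L g *\<^sub>v w \<in> U"
  obtains k P \<rho> where "P \<in> carrier_mat N k" "mat_inj P" "mat_image P \<subseteq> U"
    "irreducible_rep G k \<rho>" "\<And>g. g \<in> carrier G \<Longrightarrow> L g * P = P * \<rho> g"
proof -
  note R = mat_rep_carrier[OF rep]
  \<comment> \<open>The possible dimensions of nonzero invariant subspaces of \<open>U\<close>:
    \<open>P\<close> holds a basis and \<open>\<rho>\<close> is the action in its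
    coordinates.\<close>
  define Q where "Q k \<longleftrightarrow> k > 0 \<and> (\<exists>P \<rho>. P \<in> carrier_mat N k \<and> mat_inj P \<and> mat_image P \<subseteq> U \<and>
    (\<forall>g\<in>carrier G. \<rho> g \<in> carrier_mat k k \<and> L g * P = P * \<rho> g))" for k
  have sub: "Q k" if k: "k > 0" and P: "P \<in> carrier_mat N k" "mat_inj P" "mat_image P \<subseteq> U"
    and i: "\<And>g v. g \<in> carrier G \<Longrightarrow> v \<in> carrier_vec k \<Longrightarrow> L g *\<^sub>v (P *\<^sub>v v) \<in> mat_image P" for k P
  proof -
    have "\<exists>B\<in>carrier_mat k k. L g * P = P * B" if g: "g \<in> carrier G" for g
      using i[OF g] R[OF g] P(1)
      by (intro mat_image_factor[OF P(1)]) (auto simp: assoc_mult_mat_vec[of _ N N _ k])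
    then obtain \<rho> where "\<forall>g\<in>carrier G. \<rho> g \<in> carrier_mat k k \<and> L g * P = P * \<rho> g" by metis
    then show ?thesis using k P by (auto simp: Q_def)
  qed
  \<comment> \<open>\<open>U\<close> itself is a candidate, of positive dimension because it is
    nonzero.\<close>
  have "\<exists>k. Q k"
  proof -
    obtain k P where P: "P \<in> carrier_mat N k" "mat_inj P" "mat_image P = U"
      using vec_closed_obtains_basis[OF U] .
    have "k > 0"
    proof (rule ccontr)
      assume "\<not> k > 0"
      then have "\<forall>v \<in> carrier_vec k. P *\<^sub>v v = 0\<^sub>v N"
        using P by (auto intro!: eq_vecI simp: scalar_prod_def)
      then have "U \<subseteq> {0\<^sub>v N}" using P by (auto simp: mat_image_def)
      then show False using nz U by (auto simp: vec_closed_def)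
    qed
    then have "Q k"
      by (rule sub[OF _ P(1,2)]) (use P inv in \<open>auto simp: mat_image_def\<close>)
    then show ?thesis ..
  qed
  then obtain k where k: "Q k" and min: "\<And>k'. Q k' \<Longrightarrow> k \<le> k'"
    by (metis LeastI Least_le)
  then obtain P \<rho> where P: "k > 0" "P \<in> carrier_mat N k" "mat_inj P" "mat_image P \<subseteq> U"
    and \<rho>: "\<And>g. g \<in> carrier G \<Longrightarrow> \<rho> g \<in> carrier_mat k k"
    and eq: "\<And>g. g \<in> carrier G \<Longrightarrow> L g * P = P * \<rho> g"
    using k unfolding Q_def by blast
  have "irreducible_rep G k \<rho>"
    unfolding irreducible_rep_def subspace_iff_vec_closed
  proof (intro conjI allI impI)
    show "mat_rep G k \<rho>" by (rule subrep_hom[OF rep P(2,3) \<rho> eq])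
    show "k > 0" by fact
    fix W assume W: "vec_closed k W" and Winv: "\<forall>g\<in>carrier G. \<forall>w\<in>W. \<rho> g *\<^sub>v w \<in> W"
    obtain l S where S: "S \<in> carrier_mat k l" "mat_inj S" "mat_image S = W"
      using vec_closed_obtains_basis[OF W] .
    show "W = {0\<^sub>v k} \<or> W = carrier_vec k"
    proof (cases "l = 0")
      case True
      then have "\<forall>v \<in> carrier_vec l. S *\<^sub>v v = 0\<^sub>v k"
        using S by (auto intro!: eq_vecI simp: scalar_prod_def)
      then have "W \<subseteq> {0\<^sub>v k}" using S by (auto simp: mat_image_def)
      then show ?thesis using W by (auto simp: vec_closed_def)
    next
      case False
      have PS: "(P * S) *\<^sub>v v = P *\<^sub>v (S *\<^sub>v v)" if "v \<in> carrier_vec l" for v :: "complex vec"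
        using assoc_mult_mat_vec[OF P(2) S(1) that] .
      \<comment> \<open>The columns of \<open>S\<close> are coordinates with respect to
        \<open>P\<close>, so \<open>P * S\<close> is a basis of the copy of \<open>W\<close> inside
        \<open>U\<close>, again an invariant subspace.\<close>
      have "Q l"
      proof (rule sub)
        show "l > 0" using False by simp
        show "P * S \<in> carrier_mat N l" using P S by simp
        show "mat_inj (P * S)"
          using P S PS by (auto simp: mat_inj_def)
        show "mat_image (P * S) \<subseteq> U"
          using P S PS by (auto simp: mat_image_def)
        fix g and v :: "complex vec" assume g: "g \<in> carrier G" and v: "v \<in> carrier_vec l"
        have "\<rho> g *\<^sub>v (S *\<^sub>v v) \<in> mat_image S"
          using Winv g v S by (auto simp: mat_image_def)
        then obtain u where u: "u \<in> carrier_vec l" "\<rho> g *\<^sub>v (S *\<^sub>v v) = S *\<^sub>v u"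
          using S by (auto simp: mat_image_def)
        have Sv: "S *\<^sub>v v \<in> carrier_vec k" using S v by simp
        have "L g *\<^sub>v (P *\<^sub>v (S *\<^sub>v v)) = P *\<^sub>v (\<rho> g *\<^sub>v (S *\<^sub>v v))"
          using assoc_mult_mat_vec[OF R[OF g] P(2) Sv] assoc_mult_mat_vec[OF P(2) \<rho>[OF g] Sv]
            eq[OF g] by simp
        then have "L g *\<^sub>v ((P * S) *\<^sub>v v) = (P * S) *\<^sub>v u"
          using PS u v by simp
        then show "L g *\<^sub>v ((P * S) *\<^sub>v v) \<in> mat_image (P * S)"
          using u P S by (auto simp: mat_image_def)
      qed
      then have "k \<le> l" by (rule min)
      with mat_inj_dim_le[OF S(1,2)] have "l = k" by simp
      then show ?thesis using mat_inj_square_surj[of S k] S by auto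
    qed
  qed
  then show thesis using that P eq by blast
qed

text \<open>The sum pairs \<open>f\<close> with \<open>\<chi>\<close> without complex conjugation,
  so it is the trace of \<open>rep_sum\<close>; its vanishing says that \<open>f\<close> acts as
  zero on every irreducible representation.\<close>

lemma class_fun_orthogonal_zero:
  assumes fin: "finite (carrier G)" and f: "class_fun f"
    and orth: "\<And>\<chi>. \<chi> \<in> Irr G \<Longrightarrow> (\<Sum>g\<in>carrier G. f g * \<chi> g) = 0"
    and z: "z \<in> carrier G"
  shows "f z = 0"
proof (rule ccontr)
  assume fz: "f z \<noteq> 0"
  define N where "N = card (carrier G)"
  obtain e where e: "bij_betw e {..<N} (carrier G)"
    using ex_bij_betw_nat_finite[OF fin] by (auto simp: N_def atLeast0LessThan)
  let ?L = "regular_rep N e"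
  have L: "mat_rep G N ?L" by (rule regular_rep[OF e])
  note Lc = mat_rep_carrier[OF L]
  \<comment> \<open>The coefficients of the adjoint: in the regular representation \<open>f'\<close>
    acts by the conjugate transpose of the matrix of \<open>f\<close>, as \<open>adj\<close>
    confirms.\<close>
  define f' where "f' g = cnj (f (inv g))" for g
  have f': "class_fun f'"
    using f unfolding class_fun_def f'_def
    by (auto simp: inv_mult_group m_assoc)
  let ?A = "rep_sum N ?L f" and ?A' = "rep_sum N ?L f'"
  have ec: "e i \<in> carrier G" if "i < N" for i using e that by (auto simp: bij_betw_def)
  have adj: "?A' $$ (i,j) = cnj (?A $$ (j,i))" if "i < N" "j < N" for i j
    using that ec by (simp add: regular_rep_sum[OF e] f'_def inv_mult_group del: msum_index)
  have A: "?A \<in> carrier_mat N N" and A': "?A' \<in> carrier_mat N N" by auto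
  let ?U = "mat_image ?A'"
  \<comment> \<open>The entry of \<open>?A\<close> in the row of \<open>z\<close> and the column of
    the identity is \<open>f z\<close>, so neither \<open>?A\<close> nor its adjoint
    vanishes.\<close>
  have nz: "?U \<noteq> {0\<^sub>v N}"
  proof
    assume U: "?U = {0\<^sub>v N}"
    have "z \<in> e ` {..<N}" "\<one> \<in> e ` {..<N}" using e z by (auto simp: bij_betw_def)
    then obtain i j where ij: "i < N" "j < N" "e i = z" "e j = \<one>" by auto
    have "?A' *\<^sub>v unit_vec N i \<in> ?U" unfolding mat_image_def by simp
    then have "?A' *\<^sub>v unit_vec N i = 0\<^sub>v N" using U by simp
    from arg_cong[OF this, of "\<lambda>v. v $ j"] have "?A' $$ (j,i) = 0"
      using ij by (simp del: msum_index)
    then have "?A $$ (i,j) = 0" using adj[of j i] ij by (simp del: msum_index)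
    then show False using ij fz z by (simp add: regular_rep_sum[OF e] del: msum_index)
  qed
  have inv: "?L g *\<^sub>v w \<in> ?U" if g: "g \<in> carrier G" and w: "w \<in> ?U" for g w
  proof -
    obtain u where u: "u \<in> carrier_vec N" "w = ?A' *\<^sub>v u" using w by (auto simp: mat_image_def)
    have "?L g *\<^sub>v w = ?A' *\<^sub>v (?L g *\<^sub>v u)"
      using assoc_mult_mat_vec[OF Lc[OF g] A' u(1)] assoc_mult_mat_vec[OF A' Lc[OF g] u(1)]
        rep_sum_commute[OF L f' g] u by simp
    then show ?thesis using Lc[OF g] u by (auto simp: mat_image_def)
  qed
  obtain k P \<rho> where P: "P \<in> carrier_mat N k" "mat_inj P" "mat_image P \<subseteq> ?U"
    and irr: "irreducible_rep G k \<rho>" and eq: "\<And>g. g \<in> carrier G \<Longrightarrow> ?L g * P = P * \<rho> g"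
    using invariant_contains_irreducible[OF L vec_closed_mat_image[OF A'] nz inv] by metis
  have k: "k > 0" and rep: "mat_rep G k \<rho>" using irr by (auto simp: irreducible_rep_def)
  note rc = mat_rep_carrier[OF rep]
  have "(\<Sum>g\<in>carrier G. f g * mat_trace (\<rho> g)) = 0"
    using orth[of "restrict (\<lambda>g. mat_trace (\<rho> g)) (carrier G)"] irr by (auto simp: Irr_def)
  then have zero: "rep_sum k \<rho> f = 0\<^sub>m k k"
    unfolding rep_sum_scalar[OF irr f] by auto
  \<comment> \<open>Restricted to the subrepresentation, \<open>?A\<close> is the action of
    \<open>f\<close> under \<open>\<rho>\<close>, which is zero.\<close>
  have "?A * P = msum (carrier G) N k f (\<lambda>g. ?L g * P)"
    by (rule msum_mult[OF P(1) Lc])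
  also have "\<dots> = msum (carrier G) N k f (\<lambda>g. P * \<rho> g)"
    by (rule msum_cong) (auto simp: eq)
  also have "\<dots> = P * rep_sum k \<rho> f"
    by (rule mult_msum[symmetric, OF P(1) rc])
  finally have AP: "?A * P = 0\<^sub>m N k" using zero P by simp
  \<comment> \<open>The first basis vector of the irreducible subrepresentation, available because
    \<open>k > 0\<close>.\<close>
  define w where "w = P *\<^sub>v unit_vec k 0"
  have w0: "w \<noteq> 0\<^sub>v N"
  proof
    assume "w = 0\<^sub>v N"
    then have "unit_vec k 0 = (0\<^sub>v k :: complex vec)" using P by (auto simp: mat_inj_def w_def)
    then show False using k by (metis index_unit_vec(1) index_zero_vec(1) zero_neq_one)
  qed
  have wc: "w \<in> carrier_vec N" using P by (simp add: w_def)
  have Aw: "?A *\<^sub>v w = 0\<^sub>v N"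
  proof -
    have "?A *\<^sub>v w = 0\<^sub>m N k *\<^sub>v unit_vec k 0"
      using assoc_mult_mat_vec[OF A P(1), of "unit_vec k 0"] AP by (simp add: w_def)
    also have "\<dots> = 0\<^sub>v N" by (intro eq_vecI) auto
    finally show ?thesis .
  qed
  obtain u where u: "u \<in> carrier_vec N" "w = ?A' *\<^sub>v u"
  proof -
    have "w \<in> mat_image P" using P by (auto simp: w_def mat_image_def)
    then have "w \<in> ?U" using P(3) by blast
    then show thesis using that by (auto simp: mat_image_def)
  qed
  have wi: "w $ i = (\<Sum>j<N. cnj (?A $$ (j,i)) * u $ j)" if "i < N" for i
    using that u adj by (simp add: scalar_prod_def atLeast0LessThan del: msum_index)
  have Awi: "(\<Sum>i<N. ?A $$ (j,i) * w $ i) = 0" if "j < N" for j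
  proof -
    have "(\<Sum>i<N. ?A $$ (j,i) * w $ i) = (?A *\<^sub>v w) $ j"
      using that wc by (simp add: scalar_prod_def atLeast0LessThan del: msum_index)
    then show ?thesis using Aw that by simp
  qed
  \<comment> \<open>With \<open>w = ?A' *\<^sub>v u\<close>, the squared norm of \<open>w\<close> is
    the inner product of \<open>?A' *\<^sub>v u\<close> with \<open>w\<close>; moving the adjoint
    across leaves \<open>?A *\<^sub>v w\<close>, which is 0.\<close>
  have "(\<Sum>i<N. cnj (w $ i) * w $ i) = (\<Sum>i<N. \<Sum>j<N. ?A $$ (j,i) * cnj (u $ j) * w $ i)"
    by (intro sum.cong refl) (simp add: wi sum_distrib_right del: msum_index)
  also have "\<dots> = (\<Sum>j<N. cnj (u $ j) * (\<Sum>i<N. ?A $$ (j,i) * w $ i))"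
    by (subst sum.swap) (simp add: sum_distrib_left ac_simps del: msum_index)
  also have "\<dots> = 0" using Awi by simp
  finally have "(\<Sum>i<N. complex_of_real ((cmod (w $ i))\<^sup>2)) = 0"
    by (simp only: complex_norm_square mult.commute)
  then have "complex_of_real (\<Sum>i<N. (cmod (w $ i))\<^sup>2) = 0" by simp
  then have "(\<Sum>i<N. (cmod (w $ i))\<^sup>2) = 0" by (simp only: of_real_eq_0_iff)
  then have "\<forall>i<N. w $ i = 0" by (simp add: sum_nonneg_eq_0_iff)
  then have "w = 0\<^sub>v N" using wc by (intro eq_vecI) auto
  with w0 show False by simp
qed

end

subsection \<open>Counting factorisations\<close>

lemma set_prod_Nil [simp]: "set_prod G [] = {\<one>\<^bsub>G\<^esub>}"
  by (auto simp: set_prod_def)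

lemma set_prod_Cons:
  "set_prod G (K # Ks) = {k \<otimes>\<^bsub>G\<^esub> p | k p. k \<in> K \<and> p \<in> set_prod G Ks}"
proof -
  have "y \<in> set_prod G (K # Ks) \<longleftrightarrow> (\<exists>k p. y = k \<otimes>\<^bsub>G\<^esub> p \<and> k \<in> K \<and> p \<in> set_prod G Ks)" for y
    by (auto simp: set_prod_def list_all2_Cons2) (metis foldr.simps comp_apply)+
  then show ?thesis by blast
qed

context group
begin

text \<open>Conjugating elements are counted rather than conjugates. For finite \<open>G\<close> and
  \<open>x\<close> in \<open>G\<close> this is the order of the centralizer of \<open>x\<close>
  times the indicator of its class.\<close>

definition conj_count :: "'a \<Rightarrow> 'a \<Rightarrow> nat" where
  "conj_count x z = card {g \<in> carrier G. inv g \<otimes> x \<otimes> g = z}"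

text \<open>The iterated convolution of the functions \<open>conj_count x\<close>, starting from the
  indicator of the identity. It is the N of the overview.\<close>

primrec prod_count :: "'a list \<Rightarrow> 'a \<Rightarrow> nat" where
  "prod_count [] = (\<lambda>z. if z = \<one> then 1 else 0)"
| "prod_count (x # xs) = (\<lambda>z. \<Sum>y\<in>carrier G. conj_count x y * prod_count xs (inv y \<otimes> z))"

section \<open>Elementary facts on conjugation and conjugacy classes\<close>

lemma conj_class_closed: "x \<in> carrier G \<Longrightarrow> conj_class G x \<subseteq> carrier G"
  by (auto simp: conj_class_def)

lemma conj_class_self: "x \<in> carrier G \<Longrightarrow> x \<in> conj_class G x"
  by (auto simp: conj_class_def intro!: exI[of _ \<one>])

lemma conj_cancel:
  assumes "g \<in> carrier G" "x \<in> carrier G"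
  shows "inv g \<otimes> (g \<otimes> x \<otimes> inv g) \<otimes> g = x" "g \<otimes> (inv g \<otimes> x \<otimes> g) \<otimes> inv g = x"
  using assms by (simp_all add: m_assoc) (simp_all add: m_assoc[symmetric])

lemma conj_mult:
  assumes "h \<in> carrier G" "x \<in> carrier G" "y \<in> carrier G"
  shows "(inv h \<otimes> x \<otimes> h) \<otimes> (inv h \<otimes> y \<otimes> h) = inv h \<otimes> (x \<otimes> y) \<otimes> h"
proof -
  have "h \<otimes> (inv h \<otimes> (y \<otimes> h)) = y \<otimes> h"
    using assms by (simp add: m_assoc[symmetric])
  then show ?thesis using assms by (simp add: m_assoc)
qed

lemma conj_inv:
  assumes "h \<in> carrier G" "x \<in> carrier G"
  shows "inv (inv h \<otimes> x \<otimes> h) = inv h \<otimes> inv x \<otimes> h"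
  using assms by (simp add: inv_mult_group m_assoc)

lemma conj_class_eq:
  assumes x: "x \<in> carrier G" and y: "y \<in> conj_class G x"
  shows "conj_class G y = conj_class G x"
proof -
  have sub: "conj_class G b \<subseteq> conj_class G a" if a: "a \<in> carrier G" and b: "b \<in> conj_class G a" for a b
  proof
    fix c assume "c \<in> conj_class G b"
    then obtain g where g: "g \<in> carrier G" "c = inv g \<otimes> b \<otimes> g" by (auto simp: conj_class_def)
    obtain h where h: "h \<in> carrier G" "b = inv h \<otimes> a \<otimes> h" using b by (auto simp: conj_class_def)
    have "c = inv (h \<otimes> g) \<otimes> a \<otimes> (h \<otimes> g)" using a g h by (simp add: inv_mult_group m_assoc)
    then show "c \<in> conj_class G a" using g h by (auto simp: conj_class_def)
  qed
  obtain g where g: "g \<in> carrier G" "y = inv g \<otimes> x \<otimes> g" using y by (auto simp: conj_class_def)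
  have "x = inv (inv g) \<otimes> y \<otimes> inv g" using g x conj_cancel(2)[OF g(1) x] by simp
  then have "x \<in> conj_class G y" using g unfolding conj_class_def by blast
  moreover have "y \<in> carrier G" using y conj_class_closed[OF x] by auto
  ultimately show ?thesis using sub x y by blast
qed

lemma conj_count_pos:
  assumes "finite (carrier G)"
  shows "conj_count x z > 0 \<longleftrightarrow> z \<in> conj_class G x"
  using assms by (auto simp: conj_count_def conj_class_def card_gt_0_iff)

text \<open>The conjugating elements are grouped by the conjugate they produce. The general semiring
  allows both natural and complex summands.\<close>

lemma sum_conj_count:
  fixes F :: "'a \<Rightarrow> 'c::comm_semiring_1"
  assumes fin: "finite (carrier G)" and x: "x \<in> carrier G"
  shows "(\<Sum>z\<in>carrier G. of_nat (conj_count x z) * F z) = (\<Sum>g\<in>carrier G. F (inv g \<otimes> x \<otimes> g))"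
proof -
  have "(\<Sum>g\<in>carrier G. F (inv g \<otimes> x \<otimes> g)) =
      (\<Sum>z\<in>carrier G. \<Sum>g\<in>{g \<in> carrier G. inv g \<otimes> x \<otimes> g = z}. F (inv g \<otimes> x \<otimes> g))"
    using fin x by (intro sum.group[symmetric]) auto
  also have "\<dots> = (\<Sum>z\<in>carrier G. of_nat (conj_count x z) * F z)"
    by (intro sum.cong refl) (simp add: conj_count_def)
  finally show ?thesis ..
qed

text \<open>Right multiplication by \<open>h\<close> is a bijection between the two sets of
  conjugating elements.\<close>

lemma conj_count_conj:
  assumes x: "x \<in> carrier G" and z: "z \<in> carrier G" and h: "h \<in> carrier G"
  shows "conj_count x (inv h \<otimes> z \<otimes> h) = conj_count x z"
  unfolding conj_count_def
proof (rule bij_betw_same_card[OF bij_betw_byWitness[where f' = "\<lambda>g. g \<otimes> h"]])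
  show "\<forall>g\<in>{g \<in> carrier G. inv g \<otimes> x \<otimes> g = inv h \<otimes> z \<otimes> h}. g \<otimes> inv h \<otimes> h = g"
    using h by (auto simp: m_assoc)
  show "\<forall>g\<in>{g \<in> carrier G. inv g \<otimes> x \<otimes> g = z}. g \<otimes> h \<otimes> inv h = g"
    using h by (auto simp: m_assoc)
  show "(\<lambda>g. g \<otimes> inv h) ` {g \<in> carrier G. inv g \<otimes> x \<otimes> g = inv h \<otimes> z \<otimes> h}
      \<subseteq> {g \<in> carrier G. inv g \<otimes> x \<otimes> g = z}"
  proof clarify
    fix g assume g: "g \<in> carrier G" and eq: "inv g \<otimes> x \<otimes> g = inv h \<otimes> z \<otimes> h"
    have "inv (g \<otimes> inv h) \<otimes> x \<otimes> (g \<otimes> inv h) = h \<otimes> (inv g \<otimes> x \<otimes> g) \<otimes> inv h"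
      using g h x by (simp add: inv_mult_group m_assoc)
    then show "g \<otimes> inv h \<in> carrier G \<and> inv (g \<otimes> inv h) \<otimes> x \<otimes> (g \<otimes> inv h) = z"
      using eq conj_cancel(2)[OF h z] g h by simp
  qed
  show "(\<lambda>g. g \<otimes> h) ` {g \<in> carrier G. inv g \<otimes> x \<otimes> g = z}
      \<subseteq> {g \<in> carrier G. inv g \<otimes> x \<otimes> g = inv h \<otimes> z \<otimes> h}"
  proof clarify
    fix g assume g: "g \<in> carrier G"
    then show "g \<otimes> h \<in> carrier G \<and>
        inv (g \<otimes> h) \<otimes> x \<otimes> (g \<otimes> h) = inv h \<otimes> (inv g \<otimes> x \<otimes> g) \<otimes> h"
      using h x by (simp add: inv_mult_group m_assoc)
  qed
qed

text \<open>Conjugating by \<open>h\<close> can be absorbed into the summation variable of the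
  convolution; one factor is then invariant by \<open>conj_count_conj\<close>, the other by
  induction.\<close>

lemma prod_count_conj:
  assumes xs: "set xs \<subseteq> carrier G" and h: "h \<in> carrier G"
  shows "z \<in> carrier G \<Longrightarrow> prod_count xs (inv h \<otimes> z \<otimes> h) = prod_count xs z"
  using xs
proof (induction xs arbitrary: z)
  case Nil
  have "inv h \<otimes> z \<otimes> h = \<one> \<longleftrightarrow> z = \<one>"
  proof
    assume "inv h \<otimes> z \<otimes> h = \<one>"
    then have "z = h \<otimes> \<one> \<otimes> inv h" using conj_cancel(2)[OF h Nil(1)] by simp
    then show "z = \<one>" using h by simp
  qed (use h in simp)
  then show ?case by simp
next
  case (Cons x xs)
  have "(\<Sum>y\<in>carrier G. conj_count x y * prod_count xs (inv y \<otimes> (inv h \<otimes> z \<otimes> h))) =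
      (\<Sum>y\<in>carrier G. conj_count x y * prod_count xs (inv y \<otimes> z))"
  proof (rule sum.reindex_bij_witness[of _ "\<lambda>y. inv h \<otimes> y \<otimes> h" "\<lambda>y. h \<otimes> y \<otimes> inv h"])
    fix y assume y: "y \<in> carrier G"
    show "inv h \<otimes> (h \<otimes> y \<otimes> inv h) \<otimes> h = y" "h \<otimes> (inv h \<otimes> y \<otimes> h) \<otimes> inv h = y"
      using conj_cancel[OF h y] by auto
    show "h \<otimes> y \<otimes> inv h \<in> carrier G" "inv h \<otimes> y \<otimes> h \<in> carrier G" using y h by auto
    define y' where "y' = h \<otimes> y \<otimes> inv h"
    have y': "y' \<in> carrier G" "y = inv h \<otimes> y' \<otimes> h"
      using y h conj_cancel(1)[OF h y] by (auto simp: y'_def)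
    have "inv y \<otimes> (inv h \<otimes> z \<otimes> h) = inv h \<otimes> (inv y' \<otimes> z) \<otimes> h"
      using y' h Cons.prems(1) by (simp add: conj_inv conj_mult)
    then have "prod_count xs (inv y \<otimes> (inv h \<otimes> z \<otimes> h)) = prod_count xs (inv y' \<otimes> z)"
      using Cons y' by simp
    moreover have "conj_count x y = conj_count x y'"
      using conj_count_conj[of x y' h] y' h Cons.prems by simp
    ultimately show "conj_count x (h \<otimes> y \<otimes> inv h) * prod_count xs (inv (h \<otimes> y \<otimes> inv h) \<otimes> z) =
        conj_count x y * prod_count xs (inv y \<otimes> (inv h \<otimes> z \<otimes> h))"
      by (simp add: y'_def)
  qed
  then show ?case by simp
qed

lemma set_prod_closed:
  "set xs \<subseteq> carrier G \<Longrightarrow> set_prod G (map (conj_class G) xs) \<subseteq> carrier G"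
  by (induction xs) (use conj_class_closed in \<open>auto simp: set_prod_Cons\<close>)

text \<open>A sum of natural numbers is positive exactly when some summand is. So the product of
  classes is the support of the count, and equality of sets becomes a question about
  functions.\<close>

lemma prod_count_pos:
  assumes fin: "finite (carrier G)" and xs: "set xs \<subseteq> carrier G" and z: "z \<in> carrier G"
  shows "prod_count xs z > 0 \<longleftrightarrow> z \<in> set_prod G (map (conj_class G) xs)"
  using xs z
proof (induction xs arbitrary: z)
  case (Cons x xs)
  have x: "x \<in> carrier G" and xs: "set xs \<subseteq> carrier G" using Cons.prems by auto
  have "prod_count (x # xs) z > 0 \<longleftrightarrow>
      (\<exists>y\<in>carrier G. conj_count x y > 0 \<and> prod_count xs (inv y \<otimes> z) > 0)"
    using fin by (auto simp: sum_nonneg_eq_0_iff simp flip: neq0_conv)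
  also have "\<dots> \<longleftrightarrow> (\<exists>y\<in>carrier G. y \<in> conj_class G x \<and> inv y \<otimes> z \<in> set_prod G (map (conj_class G) xs))"
    using Cons.IH[OF xs] conj_count_pos[OF fin] Cons.prems by auto
  also have "\<dots> \<longleftrightarrow> z \<in> set_prod G (map (conj_class G) (x # xs))"
  proof
    assume "\<exists>y\<in>carrier G. y \<in> conj_class G x \<and> inv y \<otimes> z \<in> set_prod G (map (conj_class G) xs)"
    then obtain y where y: "y \<in> carrier G" "y \<in> conj_class G x"
      "inv y \<otimes> z \<in> set_prod G (map (conj_class G) xs)" by auto
    moreover have "z = y \<otimes> (inv y \<otimes> z)" using y Cons.prems by (simp add: m_assoc[symmetric])
    ultimately show "z \<in> set_prod G (map (conj_class G) (x # xs))"
      by (auto simp: set_prod_Cons)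
  next
    assume "z \<in> set_prod G (map (conj_class G) (x # xs))"
    then obtain y p where yp: "z = y \<otimes> p" "y \<in> conj_class G x" "p \<in> set_prod G (map (conj_class G) xs)"
      by (auto simp: set_prod_Cons)
    then have "y \<in> carrier G" "p \<in> carrier G"
      using conj_class_closed[OF x] set_prod_closed[OF xs] by auto
    then have "inv y \<otimes> z = p" using yp by (simp add: m_assoc[symmetric])
    then show "\<exists>y\<in>carrier G. y \<in> conj_class G x \<and> inv y \<otimes> z \<in> set_prod G (map (conj_class G) xs)"
      using yp \<open>y \<in> carrier G\<close> by auto
  qed
  finally show ?case .
qed simp

text \<open>\<open>F\<close> takes two arguments because a convolution summand may contain both the
  translated and the original element.\<close>

lemma sum_left_translate:
  fixes F :: "'a \<Rightarrow> 'a \<Rightarrow> 'c::comm_monoid_add"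
  assumes y: "y \<in> carrier G"
  shows "(\<Sum>z\<in>carrier G. F (inv y \<otimes> z) z) = (\<Sum>z\<in>carrier G. F z (y \<otimes> z))"
  by (rule sum.reindex_bij_witness[of _ "\<lambda>z. y \<otimes> z" "\<lambda>z. inv y \<otimes> z"])
    (use y in \<open>auto simp: m_assoc[symmetric]\<close>)

text \<open>Each list entry can be conjugated by any of the group elements, so it contributes a
  factor \<open>card (carrier G)\<close>.\<close>

lemma sum_prod_count:
  assumes fin: "finite (carrier G)" and xs: "set xs \<subseteq> carrier G"
  shows "(\<Sum>z\<in>carrier G. prod_count xs z) = card (carrier G) ^ length xs"
  using xs
proof (induction xs)
  case Nil
  show ?case using fin by simp
next
  case (Cons x xs)
  have "(\<Sum>z\<in>carrier G. prod_count (x # xs) z) =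
      (\<Sum>y\<in>carrier G. \<Sum>z\<in>carrier G. conj_count x y * prod_count xs (inv y \<otimes> z))"
    by (simp only: prod_count.simps, rule sum.swap)
  also have "\<dots> = (\<Sum>y\<in>carrier G. conj_count x y * (\<Sum>z\<in>carrier G. prod_count xs z))"
    using sum_left_translate[where F = "\<lambda>a b. prod_count xs a"]
    by (intro sum.cong) (auto simp: sum_distrib_left[symmetric])
  \<comment> \<open>Here \<open>of_nat\<close> maps into the naturals themselves; it gives the shape
    of \<open>sum_conj_count\<close> for a constant function.\<close>
  also have "\<dots> = (\<Sum>y\<in>carrier G. of_nat (conj_count x y) * card (carrier G) ^ length xs)"
    using Cons by simp
  also have "\<dots> = card (carrier G) ^ length (x # xs)"
    by (subst sum_conj_count[OF fin]) (use Cons.prems in auto)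
  finally show ?case .
qed

section \<open>Action of the counting functions on irreducible representations\<close>

lemma mat_trace_conj:
  assumes rep: "mat_rep G m \<rho>" and x: "x \<in> carrier G" and g: "g \<in> carrier G"
  shows "mat_trace (\<rho> (inv g \<otimes> x \<otimes> g)) = mat_trace (\<rho> x)"
proof -
  note R = mat_rep_carrier[OF rep]
  have "\<rho> (inv g \<otimes> x \<otimes> g) = \<rho> (inv g) * \<rho> (x \<otimes> g)"
    using mat_rep_mult[OF rep, of "inv g" "x \<otimes> g"] x g by (simp add: m_assoc)
  then have "mat_trace (\<rho> (inv g \<otimes> x \<otimes> g)) = mat_trace (\<rho> (x \<otimes> g) * \<rho> (inv g))"
    using mat_trace_comm[of "\<rho> (inv g)" m m "\<rho> (x \<otimes> g)"] R x g by simp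
  also have "\<rho> (x \<otimes> g) * \<rho> (inv g) = \<rho> x"
    using mat_rep_mult[OF rep, of "x \<otimes> g" "inv g"] x g by (simp add: m_assoc)
  finally show ?thesis .
qed

lemma class_fun_conj_count: "x \<in> carrier G \<Longrightarrow> class_fun (\<lambda>z. of_nat (conj_count x z))"
  by (simp add: class_fun_def conj_count_conj)

lemma class_fun_prod_count: "set xs \<subseteq> carrier G \<Longrightarrow> class_fun (\<lambda>z. of_nat (prod_count xs z))"
  by (simp add: class_fun_def prod_count_conj)

text \<open>A representation extends multiplicatively to the group algebra, whose product is
  convolution.\<close>

lemma rep_sum_convolution:
  assumes rep: "mat_rep G m \<rho>"
  shows "rep_sum m \<rho> (\<lambda>z. \<Sum>y\<in>carrier G. f y * h (inv y \<otimes> z)) = rep_sum m \<rho> f * rep_sum m \<rho> h"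
proof -
  note R = mat_rep_carrier[OF rep]
  have "rep_sum m \<rho> f * rep_sum m \<rho> h = rep_sum m (\<lambda>y. \<rho> y * rep_sum m \<rho> h) f"
    by (rule msum_mult) (use R in auto)
  also have "\<dots> = rep_sum m (\<lambda>y. rep_sum m (\<lambda>z. \<rho> (y \<otimes> z)) h) f"
  proof (rule msum_cong)
    fix y assume y: "y \<in> carrier G"
    have "\<rho> y * rep_sum m \<rho> h = rep_sum m (\<lambda>z. \<rho> y * \<rho> z) h"
      by (rule mult_msum) (use R y in auto)
    also have "\<dots> = rep_sum m (\<lambda>z. \<rho> (y \<otimes> z)) h"
      by (rule msum_cong) (use mat_rep_mult[OF rep y] in auto)
    finally show "\<rho> y * rep_sum m \<rho> h = rep_sum m (\<lambda>z. \<rho> (y \<otimes> z)) h" .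
  qed simp
  also have "\<dots> = rep_sum m \<rho> (\<lambda>z. \<Sum>y\<in>carrier G. f y * h (inv y \<otimes> z))"
  proof (rule eq_matI)
    fix i j assume "i < dim_row (rep_sum m \<rho> (\<lambda>z. \<Sum>y\<in>carrier G. f y * h (inv y \<otimes> z)))"
      "j < dim_col (rep_sum m \<rho> (\<lambda>z. \<Sum>y\<in>carrier G. f y * h (inv y \<otimes> z)))"
    then have ij: "i < m" "j < m" by auto
    have "(\<Sum>y\<in>carrier G. f y * (\<Sum>z\<in>carrier G. h z * \<rho> (y \<otimes> z) $$ (i,j))) =
        (\<Sum>y\<in>carrier G. \<Sum>z\<in>carrier G. f y * (h (inv y \<otimes> z) * \<rho> z $$ (i,j)))"
      using sum_left_translate[where F = "\<lambda>a b. h a * \<rho> b $$ (i,j)"]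
      by (intro sum.cong) (auto simp: sum_distrib_left[symmetric])
    also have "\<dots> = (\<Sum>z\<in>carrier G. (\<Sum>y\<in>carrier G. f y * h (inv y \<otimes> z)) * \<rho> z $$ (i,j))"
      by (subst sum.swap) (simp add: sum_distrib_right mult.assoc)
    finally show "rep_sum m (\<lambda>y. rep_sum m (\<lambda>z. \<rho> (y \<otimes> z)) h) f $$ (i,j) =
        rep_sum m \<rho> (\<lambda>z. \<Sum>y\<in>carrier G. f y * h (inv y \<otimes> z)) $$ (i,j)"
      using ij by simp
  qed auto
  finally show ?thesis ..
qed

text \<open>The convolution factors become scalar matrices, which multiply. Each factor |G|
  \<chi>(x) / \<chi>(1) is the central character at the class sum of x times the centralizer
  order.\<close>

lemma rep_sum_prod_count:
  assumes fin: "finite (carrier G)" and irr: "irreducible_rep G m \<rho>" and xs: "set xs \<subseteq> carrier G"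
  shows "rep_sum m \<rho> (\<lambda>z. of_nat (prod_count xs z)) =
    (\<Prod>x\<leftarrow>xs. of_nat (card (carrier G)) * mat_trace (\<rho> x) / of_nat m) \<cdot>\<^sub>m 1\<^sub>m m"
  using xs
proof (induction xs)
  case Nil
  have rep: "mat_rep G m \<rho>" using irr by (auto simp: irreducible_rep_def)
  show ?case
  proof (rule eq_matI)
    fix i j assume ij: "i < dim_row ((\<Prod>x\<leftarrow>[]. of_nat (card (carrier G)) * mat_trace (\<rho> x) / of_nat m) \<cdot>\<^sub>m 1\<^sub>m m)"
      "j < dim_col ((\<Prod>x\<leftarrow>[]. of_nat (card (carrier G)) * mat_trace (\<rho> x) / of_nat m) \<cdot>\<^sub>m 1\<^sub>m m)"
    have "(\<Sum>z\<in>carrier G. of_nat (prod_count [] z) * \<rho> z $$ (i,j)) =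
        (\<Sum>z\<in>carrier G. if z = \<one> then \<rho> z $$ (i,j) else 0)"
      by (intro sum.cong) auto
    also have "\<dots> = \<rho> \<one> $$ (i,j)" using fin by simp
    finally show "rep_sum m \<rho> (\<lambda>z. of_nat (prod_count [] z)) $$ (i,j) =
       ((\<Prod>x\<leftarrow>[]. of_nat (card (carrier G)) * mat_trace (\<rho> x) / of_nat m) \<cdot>\<^sub>m 1\<^sub>m m) $$ (i,j)"
      using ij mat_rep_one[OF rep] by simp
  qed auto
next
  case (Cons x xs)
  have rep: "mat_rep G m \<rho>" using irr by (auto simp: irreducible_rep_def)
  have x: "x \<in> carrier G" using Cons.prems by simp
  have "(\<Sum>z\<in>carrier G. of_nat (conj_count x z) * mat_trace (\<rho> z)) =
      of_nat (card (carrier G)) * mat_trace (\<rho> x)"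
    by (simp add: sum_conj_count[OF fin x] mat_trace_conj[OF rep x])
  then have "rep_sum m \<rho> (\<lambda>z. of_nat (conj_count x z)) =
      (of_nat (card (carrier G)) * mat_trace (\<rho> x) / of_nat m) \<cdot>\<^sub>m 1\<^sub>m m"
    by (simp add: rep_sum_scalar[OF irr class_fun_conj_count[OF x]])
  moreover have "rep_sum m \<rho> (\<lambda>z. of_nat (prod_count (x # xs) z)) =
      rep_sum m \<rho> (\<lambda>z. of_nat (conj_count x z)) * rep_sum m \<rho> (\<lambda>z. of_nat (prod_count xs z))"
    by (subst rep_sum_convolution[OF rep, symmetric]) simp
  ultimately show ?case
    using Cons by (simp add: scalar_mat_mult)
qed

subsection \<open>Products of conjugacy classes\<close>

lemma Irr_one_nonzero: "\<chi> \<in> Irr G \<Longrightarrow> \<chi> \<one> \<noteq> 0"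
  by (auto simp: Irr_def irreducible_rep_def mat_rep_one mat_trace_def)

lemma Irr_conj: "\<chi> \<in> Irr G \<Longrightarrow> x \<in> carrier G \<Longrightarrow> g \<in> carrier G \<Longrightarrow> \<chi> (inv g \<otimes> x \<otimes> g) = \<chi> x"
  by (auto simp: Irr_def irreducible_rep_def mat_trace_conj)

text \<open>The same scalar is computed twice, from the trace and from the convolution factors.
  Denominators are cleared so that the identity contains only values of
  \<open>\<chi>\<close>.\<close>

lemma Irr_sum_prod_count:
  assumes fin: "finite (carrier G)" and \<chi>: "\<chi> \<in> Irr G" and xs: "set xs \<subseteq> carrier G"
  shows "(\<Sum>z\<in>carrier G. of_nat (prod_count xs z) * \<chi> z) * \<chi> \<one> ^ length xs =
    \<chi> \<one> * of_nat (card (carrier G)) ^ length xs * (\<Prod>x\<leftarrow>xs. \<chi> x)"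
proof -
  obtain m \<rho> where irr: "irreducible_rep G m \<rho>"
    and \<chi>_def: "\<chi> = restrict (\<lambda>g. mat_trace (\<rho> g)) (carrier G)"
    using \<chi> by (auto simp: Irr_def)
  have m: "m > 0" and rep: "mat_rep G m \<rho>"
    using irr by (auto simp: irreducible_rep_def)
  have one: "\<chi> \<one> = of_nat m" by (simp add: \<chi>_def mat_rep_one[OF rep] mat_trace_def)
  let ?S = "\<Sum>z\<in>carrier G. of_nat (prod_count xs z) * \<chi> z"
  have "?S / of_nat m = rep_sum m \<rho> (\<lambda>z. of_nat (prod_count xs z)) $$ (0,0)"
    unfolding rep_sum_scalar[OF irr class_fun_prod_count[OF xs]] using m by (simp add: \<chi>_def)
  also have "\<dots> = (\<Prod>x\<leftarrow>xs. of_nat (card (carrier G)) * mat_trace (\<rho> x) / of_nat m)"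
    unfolding rep_sum_prod_count[OF fin irr xs] using m by simp
  also have "\<dots> * of_nat m ^ length xs = of_nat (card (carrier G)) ^ length xs * (\<Prod>x\<leftarrow>xs. \<chi> x)"
    using xs m by (induction xs) (auto simp: \<chi>_def)
  finally show ?thesis using m by (simp add: one field_simps)
qed

lemma set_prod_conj_class_iff:
  assumes fin: "finite (carrier G)" and xs: "set xs \<subseteq> carrier G" and ne: "xs \<noteq> []"
    and d: "d \<in> carrier G"
  shows "set_prod G (map (conj_class G) xs) = conj_class G d \<longleftrightarrow>
    (\<forall>\<chi>\<in>Irr G. (\<Prod>x\<leftarrow>xs. \<chi> x) = \<chi> \<one> ^ (length xs - 1) * \<chi> d)"
proof -
  define c :: complex where "c = of_nat (card (carrier G))"
  have c: "c \<noteq> 0" using fin one_closed by (auto simp: c_def)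
  obtain l where l: "length xs = Suc l" using ne by (cases xs) auto
  show ?thesis
  proof
    assume eq: "set_prod G (map (conj_class G) xs) = conj_class G d"
    show "\<forall>\<chi>\<in>Irr G. (\<Prod>x\<leftarrow>xs. \<chi> x) = \<chi> \<one> ^ (length xs - 1) * \<chi> d"
    proof
      fix \<chi> assume \<chi>: "\<chi> \<in> Irr G"
      \<comment> \<open>The count vanishes off the class of \<open>d\<close>, and on that class
        \<open>\<chi>\<close> is constant.\<close>
      have "of_nat (prod_count xs z) * \<chi> z = of_nat (prod_count xs z) * \<chi> d" if z: "z \<in> carrier G" for z
      proof (cases "prod_count xs z > 0")
        case True
        then have "z \<in> conj_class G d" using prod_count_pos[OF fin xs z] eq by simp
        then show ?thesis using Irr_conj[OF \<chi> d] by (auto simp: conj_class_def)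
      qed simp
      then have "(\<Sum>z\<in>carrier G. of_nat (prod_count xs z) * \<chi> z) =
          (\<Sum>z\<in>carrier G. of_nat (prod_count xs z) * \<chi> d)"
        by (intro sum.cong refl)
      also have "\<dots> = of_nat (\<Sum>z\<in>carrier G. prod_count xs z) * \<chi> d"
        by (simp add: sum_distrib_right)
      finally have "c ^ Suc l * \<chi> d * \<chi> \<one> ^ Suc l = \<chi> \<one> * c ^ Suc l * (\<Prod>x\<leftarrow>xs. \<chi> x)"
        using Irr_sum_prod_count[OF fin \<chi> xs] by (simp add: sum_prod_count[OF fin xs] l c_def)
      then show "(\<Prod>x\<leftarrow>xs. \<chi> x) = \<chi> \<one> ^ (length xs - 1) * \<chi> d"
        using c Irr_one_nonzero[OF \<chi>] by (simp add: l mult.commute)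
    qed
  next
    assume eq: "\<forall>\<chi>\<in>Irr G. (\<Prod>x\<leftarrow>xs. \<chi> x) = \<chi> \<one> ^ (length xs - 1) * \<chi> d"
    \<comment> \<open>The factor \<open>c ^ l\<close> balances the totals:
      \<open>prod_count xs\<close> sums to |G|^(l+1) over the group, and \<open>conj_count d\<close>
      to |G|.\<close>
    define f where "f z = of_nat (prod_count xs z) - c ^ l * of_nat (conj_count d z)" for z
    have f: "class_fun f"
      using class_fun_prod_count[OF xs] class_fun_conj_count[OF d]
      by (simp add: class_fun_def f_def)
    have "(\<Sum>z\<in>carrier G. f z * \<chi> z) = 0" if \<chi>: "\<chi> \<in> Irr G" for \<chi>
    proof -
      have "(\<Sum>z\<in>carrier G. of_nat (prod_count xs z) * \<chi> z) * \<chi> \<one> ^ Suc l =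
          c ^ Suc l * \<chi> d * \<chi> \<one> ^ Suc l"
        using Irr_sum_prod_count[OF fin \<chi> xs] bspec[OF eq \<chi>]
        by (simp only: l c_def diff_Suc_1 power_Suc mult_ac)
      then have "(\<Sum>z\<in>carrier G. of_nat (prod_count xs z) * \<chi> z) = c ^ Suc l * \<chi> d"
        using Irr_one_nonzero[OF \<chi>] by simp
      moreover have "(\<Sum>z\<in>carrier G. of_nat (conj_count d z) * \<chi> z) = c * \<chi> d"
        using Irr_conj[OF \<chi> d] by (simp add: sum_conj_count[OF fin d] c_def)
      moreover have "(\<Sum>z\<in>carrier G. f z * \<chi> z) =
          (\<Sum>z\<in>carrier G. of_nat (prod_count xs z) * \<chi> z) -
          c ^ l * (\<Sum>z\<in>carrier G. of_nat (conj_count d z) * \<chi> z)"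
        by (simp add: f_def left_diff_distrib sum_subtractf sum_distrib_left mult.assoc)
      ultimately show ?thesis by simp
    qed
    then have "f z = 0" if "z \<in> carrier G" for z
      using class_fun_orthogonal_zero[OF fin f] that by blast
    then have eq0: "of_nat (prod_count xs z) = c ^ l * of_nat (conj_count d z)"
      if "z \<in> carrier G" for z
      using that by (simp add: f_def)
    \<comment> \<open>The two counts differ by the nonzero factor \<open>c ^ l\<close>, so they have
      the same support.\<close>
    have pos: "prod_count xs z > 0 \<longleftrightarrow> conj_count d z > 0" if "z \<in> carrier G" for z
    proof -
      have "of_nat (prod_count xs z) = (0::complex) \<longleftrightarrow> of_nat (conj_count d z) = (0::complex)"
        unfolding eq0[OF that] using c by simp
      then show ?thesis by (simp only: of_nat_eq_0_iff neq0_conv[symmetric])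
    qed
    have mem: "z \<in> set_prod G (map (conj_class G) xs) \<longleftrightarrow> z \<in> conj_class G d"
      if "z \<in> carrier G" for z
      using pos[OF that] prod_count_pos[OF fin xs that] conj_count_pos[OF fin, of d z] by simp
    show "set_prod G (map (conj_class G) xs) = conj_class G d"
    proof (rule Set.set_eqI)
      show "z \<in> set_prod G (map (conj_class G) xs) \<longleftrightarrow> z \<in> conj_class G d" for z
        using mem[of z] set_prod_closed[OF xs] conj_class_closed[OF d] by (cases "z \<in> carrier G") auto
    qed
  qed
qed

section \<open>Powers of a single conjugacy class\<close>

lemma pow_in_set_prod:
  "x \<in> carrier G \<Longrightarrow> x [^] n \<in> set_prod G (map (conj_class G) (replicate n x))"
proof (induction n)
  case (Suc n)
  then show ?case
    using conj_class_self nat_pow_Suc2 by (auto simp: set_prod_Cons simp del: nat_pow_Suc)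
qed simp

text \<open>The power of the class contains \<open>x [^] n\<close>, so the only class it can equal
  is that of \<open>x [^] n\<close>; the criterion for products then applies with this element as
  \<open>d\<close>.\<close>

lemma replicate_conj_class_iff:
  assumes fin: "finite (carrier G)" and n: "n \<ge> 1" and x: "x \<in> carrier G"
  shows "set_prod G (replicate n (conj_class G x)) \<in> conj_classes G \<longleftrightarrow>
    (\<forall>\<chi>\<in>Irr G. \<chi> x ^ n = \<chi> \<one> ^ (n - 1) * \<chi> (x [^] n))"
proof -
  let ?P = "set_prod G (replicate n (conj_class G x))"
  have xn: "x [^] n \<in> carrier G" "x [^] n \<in> ?P"
    using x pow_in_set_prod[OF x, of n] by auto
  have "?P \<in> conj_classes G \<longleftrightarrow> ?P = conj_class G (x [^] n)"
  proof
    assume "?P \<in> conj_classes G"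
    then obtain y where y: "y \<in> carrier G" "?P = conj_class G y" by (auto simp: conj_classes_def)
    show "?P = conj_class G (x [^] n)"
      using conj_class_eq[OF y(1), of "x [^] n"] xn(2) unfolding y(2) by simp
  qed (use xn in \<open>auto simp: conj_classes_def\<close>)
  also have "\<dots> \<longleftrightarrow> (\<forall>\<chi>\<in>Irr G. \<chi> x ^ n = \<chi> \<one> ^ (n - 1) * \<chi> (x [^] n))"
    using set_prod_conj_class_iff[OF fin, of "replicate n x" "x [^] n"] n x xn
    by (simp add: prod_list_replicate)
  finally show ?thesis .
qed

end

theorem theorem7:
  fixes G :: "('a, 'b) monoid_scheme" (structure)
  assumes "group G" and "finite (carrier G)"
  shows "(\<forall>(n::nat) x d. n \<ge> 1 \<longrightarrow> (\<forall>i\<in>{1..n}. x i \<in> carrier G) \<longrightarrow> d \<in> carrier G \<longrightarrow>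
            (set_prod G (map (\<lambda>i. conj_class G (x i)) [1..<Suc n]) = conj_class G d \<longleftrightarrow>
             (\<forall>\<chi>\<in>Irr G. (\<Prod>i\<in>{1..n}. \<chi> (x i)) = \<chi> \<one> ^ (n - 1) * \<chi> d))) \<and>
         (\<forall>(n::nat) K x. n \<ge> 1 \<longrightarrow> K \<in> conj_classes G \<longrightarrow> x \<in> K \<longrightarrow>
            (set_prod G (replicate n K) \<in> conj_classes G \<longleftrightarrow>
             (\<forall>\<chi>\<in>Irr G. \<chi> x ^ n = \<chi> \<one> ^ (n - 1) * \<chi> (x [^] n))))"
proof (intro conjI allI impI)
  interpret group G by fact
  fix n :: nat and x d
  assume n: "n \<ge> 1" and x: "\<forall>i\<in>{1..n}. x i \<in> carrier G" and d: "d \<in> carrier G"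
  have set: "set (map x [1..<Suc n]) \<subseteq> carrier G" using x by auto
  \<comment> \<open>The index list has no repetitions, so the product along it is the product over
    the index set, even if the values of \<open>x\<close> repeat.\<close>
  have "(\<Prod>y\<leftarrow>map x [1..<Suc n]. \<chi> y) = (\<Prod>i\<in>{1..n}. \<chi> (x i))" for \<chi> :: "'a \<Rightarrow> complex"
    by (simp only: map_map comp_def)
      (subst prod.distinct_set_conv_list[symmetric],
        auto intro!: prod.cong simp: atLeastLessThanSuc_atLeastAtMost)
  moreover have "length (map x [1..<Suc n]) = n" and ne: "map x [1..<Suc n] \<noteq> []" using n by auto
  ultimately show "set_prod G (map (\<lambda>i. conj_class G (x i)) [1..<Suc n]) = conj_class G d \<longleftrightarrow>
      (\<forall>\<chi>\<in>Irr G. (\<Prod>i\<in>{1..n}. \<chi> (x i)) = \<chi> \<one> ^ (n - 1) * \<chi> d)"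
    using set_prod_conj_class_iff[OF assms(2) set ne d] by (simp only: map_map comp_def)
next
  interpret group G by fact
  fix n :: nat and K x
  assume n: "n \<ge> 1" and K: "K \<in> conj_classes G" and x: "x \<in> K"
  obtain y where y: "y \<in> carrier G" "K = conj_class G y" using K by (auto simp: conj_classes_def)
  \<comment> \<open>Any element represents its class, so the given \<open>x\<close> can replace the
    representative \<open>y\<close>.\<close>
  have "K = conj_class G x" using conj_class_eq[OF y(1), of x] x y(2) by simp
  moreover have "x \<in> carrier G" using conj_class_closed[OF y(1)] x y(2) by auto
  ultimately show "set_prod G (replicate n K) \<in> conj_classes G \<longleftrightarrow>
      (\<forall>\<chi>\<in>Irr G. \<chi> x ^ n = \<chi> \<one> ^ (n - 1) * \<chi> (x [^] n))"
    using replicate_conj_class_iff[OF assms(2) n] by simp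
qed

end
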